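(* Let $M=\frac{-1-\sqrt{2}}{2}$ and let $r$ be an odd positive integer. Choosing at each step the smallest allowed positive integer in the following procedure — $a_r=2$, $s_r=1-\frac{M+1}{a_r}$, and for $i=r-1,\ldots,1$: if $i$ is odd, $a_i=1+\left\lfloor\frac{-M-1}{1-s_{i+1}}\right\rfloor$ and $s_i=f\!\left(s_{i+1},1-\frac{M+1}{a_i}\right)$; if $i$ is even, $a_i=1+\left\lfloor -M+\frac{M}{s_{i+1}}\right\rfloor$ and $s_i=g\!\left(s_{i+1},-\frac{M}{a_i}\right)$ — yields $a_1=\cdots=a_{r-1}=1$, and $T_G(1,\ldots,1,2)$ is $[M,-1)$-eigenvalue free. Consequently, no threshold graph $T_G(a_1,\ldots,a_r)$ with $r$ odd, $a_r\ge 2$ and $a_i\ge 1$ for $1\le i\le r-1$ has an eigenvalue in the interval $[M,-1)$.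
   Context: All graphs are finite, simple and undirected; eigenvalues are those of the adjacency matrix. A graph is $I$-eigenvalue free if it has no eigenvalue in the interval $I$. For an integer $r\ge 1$ and positive integers $a_1,\ldots,a_r$ with $a_r\ge 2$, the threshold graph $T_G(a_1,\ldots,a_r)$ is defined as follows: start with $G_r=K_{a_r}$ if $r$ is odd and $G_r=\overline{K_{a_r}}$ if $r$ is even; for $i=r-1,\ldots,1$, obtain $G_i$ from $G_{i+1}$ by adding $a_i$ new vertices adjacent to each other and to all vertices of $G_{i+1}$ if $i$ is odd, and $a_i$ new isolated vertices if $i$ is even; then $T_G(a_1,\ldots,a_r)=G_1$. Here $f(X,Y)=\frac{XY-1}{X+Y-2}$ and $g(X,Y)=\frac{XY}{X+Y}$. *)

theory Defs
  imports Complex_Main "Jordan_Normal_Form.Char_Poly"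
begin

text \<open>A finite simple undirected graph is a pair \<open>(n, E)\<close>: the vertex set is \<open>{..<n}\<close> and
  \<open>E\<close> is a set of two-element subsets of it.\<close>

type_synonym ugraph = "nat \<times> nat set set"

definition is_ugraph :: "ugraph \<Rightarrow> bool" where
  "is_ugraph G \<longleftrightarrow> (\<forall>e\<in>snd G. e \<subseteq> {..<fst G} \<and> card e = 2)"

definition adj_mat :: "ugraph \<Rightarrow> real mat" where
  "adj_mat G = mat (fst G) (fst G) (\<lambda>(u, v). if {u, v} \<in> snd G then 1 else 0)"

definition eigenvalue_free :: "real set \<Rightarrow> ugraph \<Rightarrow> bool" where
  "eigenvalue_free I G \<longleftrightarrow> \<not> (\<exists>x\<in>I. eigenvalue (adj_mat G) x)"

definition complete_graph :: "nat \<Rightarrow> ugraph" where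
  "complete_graph n = (n, {{u, v} | u v. u < n \<and> v < n \<and> u \<noteq> v})"

definition empty_graph :: "nat \<Rightarrow> ugraph" where
  "empty_graph n = (n, {})"

text \<open>In the next two definitions the \<open>k\<close> new vertices are \<open>n, \<dots>, n + k - 1\<close>.\<close>

definition add_dominating :: "nat \<Rightarrow> ugraph \<Rightarrow> ugraph" where
  "add_dominating k G = (let n = fst G in
     (n + k, snd G \<union> {{u, v} | u v. u \<in> {n..<n + k} \<and> v < n + k \<and> u \<noteq> v}))"

definition add_isolated :: "nat \<Rightarrow> ugraph \<Rightarrow> ugraph" where
  "add_isolated k G = (let n = fst G in (n + k, snd G))"

text \<open>\<open>threshold_stage r a k\<close> is the intermediate graph $G_{r-k}$.\<close>

fun threshold_stage :: "nat \<Rightarrow> (nat \<Rightarrow> nat) \<Rightarrow> nat \<Rightarrow> ugraph" where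
  "threshold_stage r a 0 = (if odd r then complete_graph (a r) else empty_graph (a r))"
| "threshold_stage r a (Suc k) = (let i = r - Suc k in
     if odd i then add_dominating (a i) (threshold_stage r a k)
     else add_isolated (a i) (threshold_stage r a k))"

text \<open>\<open>threshold_graph r a\<close> is $T_G(a_1,\ldots,a_r)$; only the values of \<open>a\<close> on \<open>{1..r}\<close> matter.\<close>

definition threshold_graph :: "nat \<Rightarrow> (nat \<Rightarrow> nat) \<Rightarrow> ugraph" where
  "threshold_graph r a = threshold_stage r a (r - 1)"

definition f_op :: "real \<Rightarrow> real \<Rightarrow> real" where
  "f_op X Y = (X * Y - 1) / (X + Y - 2)"

definition g_op :: "real \<Rightarrow> real \<Rightarrow> real" where
  "g_op X Y = (X * Y) / (X + Y)"

definition procedure_run :: "real \<Rightarrow> nat \<Rightarrow> (nat \<Rightarrow> nat) \<Rightarrow> (nat \<Rightarrow> real) \<Rightarrow> bool" where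
  "procedure_run M r a s \<longleftrightarrow>
     a r = 2 \<and> s r = 1 - (M + 1) / real (a r) \<and>
     (\<forall>i\<in>{1..<r}.
        (odd i \<longrightarrow>
           int (a i) = 1 + \<lfloor>(- M - 1) / (1 - s (i + 1))\<rfloor> \<and>
           s i = f_op (s (i + 1)) (1 - (M + 1) / real (a i))) \<and>
        (even i \<longrightarrow>
           int (a i) = 1 + \<lfloor>- M + M / s (i + 1)\<rfloor> \<and>
           s i = g_op (s (i + 1)) (- (M / real (a i)))))"

text \<open>Division by zero is total in HOL, so the claim that the procedure never divides by zero
  is made explicit.\<close>

definition procedure_defined :: "real \<Rightarrow> nat \<Rightarrow> (nat \<Rightarrow> nat) \<Rightarrow> (nat \<Rightarrow> real) \<Rightarrow> bool" where
  "procedure_defined M r a s \<longleftrightarrow>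
     (\<forall>i\<in>{1..<r}.
        a i \<noteq> 0 \<and>
        (odd i \<longrightarrow> 1 - s (i + 1) \<noteq> 0 \<and> s (i + 1) + (1 - (M + 1) / real (a i)) - 2 \<noteq> 0) \<and>
        (even i \<longrightarrow> s (i + 1) \<noteq> 0 \<and> s (i + 1) + - (M / real (a i)) \<noteq> 0))"

lemma is_ugraph_add_dominating:
  assumes "is_ugraph G" shows "is_ugraph (add_dominating k G)"
  using assms by (fastforce simp: is_ugraph_def add_dominating_def Let_def)

lemma is_ugraph_threshold_stage: "is_ugraph (threshold_stage r a k)"
proof (induction k)
  case 0
  show ?case by (auto simp: is_ugraph_def complete_graph_def empty_graph_def)
next
  case (Suc k)
  then have "is_ugraph (add_isolated m (threshold_stage r a k))" for m
    by (fastforce simp: is_ugraph_def add_isolated_def Let_def)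
  with Suc show ?case by (simp add: Let_def is_ugraph_add_dominating)
qed

lemma is_ugraph_threshold_graph: "is_ugraph (threshold_graph r a)"
  by (simp add: threshold_graph_def is_ugraph_threshold_stage)

end

theory Submission
  imports Defs
begin

text \<open>Let \<open>x \<in> [M, -1)\<close>. On the vertices of an intermediate graph \<open>G\<close>, an \<open>x\<close>-eigenvector of the final
  graph solves \<open>A\<^sub>G v + c 1 = x v\<close>, where \<open>c\<close> is the total weight of the dominating vertices added
  later. Put \<open>D = c + \<Sum>v\<close>. Adding \<open>k\<close> dominating vertices keeps \<open>D\<close> and replaces the \<open>c\<close> of the
  smaller graph by \<open>c - k D / (x + 1)\<close>; adding \<open>k\<close> isolated vertices keeps \<open>c\<close> and replaces \<open>D\<close> by
  \<open>D + k c / x\<close>. For \<open>x = M\<close> and \<open>k = 1\<close> the composition of the two steps acts on \<open>c / D\<close> as a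
  parabolic Moebius map with double fixed point \<open>1 + sqrt 2\<close>. Hence every nonzero solution has
  \<open>c / D > 1 + sqrt 2\<close> after a dominating step and \<open>c / D > - (1 + sqrt 2)\<close> after an isolated step.
  The final graph has \<open>c = 0\<close> and ends with a dominating step, so there is no nonzero solution.\<close>

section \<open>The shifted eigenvalue equation and its restriction to a smaller graph\<close>

definition shifted_eigen :: "real \<Rightarrow> ugraph \<Rightarrow> (nat \<Rightarrow> real) \<Rightarrow> real \<Rightarrow> bool" where
  "shifted_eigen x G v c \<longleftrightarrow>
     (\<forall>u<fst G. (\<Sum>w<fst G. if {u, w} \<in> snd G then v w else 0) + c = x * v u)"

text \<open>\<open>c + (\<Sum>w<fst G. v w) \<noteq> 0\<close> has to be stated separately: a
  quotient by zero is 0 and would exceed a negative bound. Only the entries of \<open>v\<close> at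
  vertices count, so a solution is trivial once these vanish.\<close>

definition slope_above :: "real \<Rightarrow> real \<Rightarrow> ugraph \<Rightarrow> bool" where
  "slope_above \<theta> x G \<longleftrightarrow> (\<forall>v c. shifted_eigen x G v c \<longrightarrow>
     (c = 0 \<and> (\<forall>u<fst G. v u = 0)) \<or>
     (c + (\<Sum>w<fst G. v w) \<noteq> 0 \<and> c / (c + (\<Sum>w<fst G. v w)) > \<theta>))"

lemma sum_lessThan_add:
  fixes h :: "nat \<Rightarrow> real"
  shows "(\<Sum>w<n + k. h w) = (\<Sum>w<n. h w) + (\<Sum>w\<in>{n..<n + k}. h w)"
  by (simp add: lessThan_atLeast0 sum.atLeastLessThan_concat)

lemma is_ugraph_edge:
  assumes "is_ugraph G" "{u, w} \<in> snd G"
  shows "u < fst G" "w < fst G" "u \<noteq> w"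
proof -
  have "{u, w} \<subseteq> {..<fst G}" "card {u, w} = 2"
    using assms by (auto simp: is_ugraph_def)
  then show "u < fst G" "w < fst G" "u \<noteq> w" by auto
qed

lemma edge_add_dominating:
  "{u, w} \<in> snd (add_dominating k G) \<longleftrightarrow> {u, w} \<in> snd G \<or>
     (u \<noteq> w \<and> u < fst G + k \<and> w < fst G + k \<and> (fst G \<le> u \<or> fst G \<le> w))"
proof -
  have "(\<exists>p q. {u, w} = {p, q} \<and> p \<in> {fst G..<fst G + k} \<and> q < fst G + k \<and> p \<noteq> q) \<longleftrightarrow>
     u \<noteq> w \<and> u < fst G + k \<and> w < fst G + k \<and> (fst G \<le> u \<or> fst G \<le> w)"
    unfolding doubleton_eq_iff by auto
  then show ?thesis by (simp add: add_dominating_def Let_def)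
qed

lemma fst_add_dominating [simp]: "fst (add_dominating k G) = fst G + k"
  by (simp add: add_dominating_def Let_def)

lemma fst_add_isolated [simp]: "fst (add_isolated k G) = fst G + k"
  and snd_add_isolated [simp]: "snd (add_isolated k G) = snd G"
  by (simp_all add: add_isolated_def Let_def)

text \<open>Rows of old vertices do not see the new ones; in the row of a new vertex only the
  constant \<open>c\<close> remains.\<close>

lemma shifted_eigen_add_isolated:
  assumes "is_ugraph G" and eig: "shifted_eigen x (add_isolated k G) v c"
  shows "shifted_eigen x G v c" and "\<And>u. u \<in> {fst G..<fst G + k} \<Longrightarrow> c = x * v u"
proof -
  let ?n = "fst G"
  note edge = is_ugraph_edge[OF assms(1)]
  have eq: "(\<Sum>w<?n + k. if {u, w} \<in> snd G then v w else 0) + c = x * v u" if "u < ?n + k" for u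
    using eig that by (simp add: shifted_eigen_def)
  have "(\<Sum>w\<in>{?n..<?n + k}. if {u, w} \<in> snd G then v w else 0) = 0" for u
    using edge(2) by (intro sum.neutral) fastforce
  then show "shifted_eigen x G v c"
    using eq by (simp add: shifted_eigen_def sum_lessThan_add)
  show "c = x * v u" if u: "u \<in> {?n..<?n + k}" for u
  proof -
    have "(\<Sum>w<?n + k. if {u, w} \<in> snd G then v w else 0) = 0"
      using edge(1) u by (intro sum.neutral) fastforce
    then show ?thesis using eq[of u] u by simp
  qed
qed

text \<open>To an old vertex the new vertices contribute the same total, which is absorbed into the
  constant. A new vertex sees everything except itself; the missing own entry turns \<open>x\<close>
  into \<open>x + 1\<close>.\<close>

lemma shifted_eigen_add_dominating:
  assumes "is_ugraph G" and eig: "shifted_eigen x (add_dominating k G) v c"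
  shows "shifted_eigen x G v (c + (\<Sum>w\<in>{fst G..<fst G + k}. v w))"
    and "\<And>u. u \<in> {fst G..<fst G + k} \<Longrightarrow> c + (\<Sum>w<fst G + k. v w) = (x + 1) * v u"
proof -
  let ?n = "fst G" and ?E = "snd (add_dominating k G)"
  note edge = is_ugraph_edge[OF assms(1)]
  have eq: "(\<Sum>w<?n + k. if {u, w} \<in> ?E then v w else 0) + c = x * v u" if "u < ?n + k" for u
    using eig that by (simp add: shifted_eigen_def)
  show "shifted_eigen x G v (c + (\<Sum>w\<in>{?n..<?n + k}. v w))"
    unfolding shifted_eigen_def
  proof (intro allI impI)
    fix u assume u: "u < ?n"
    have "(\<Sum>w<?n. if {u, w} \<in> ?E then v w else 0) = (\<Sum>w<?n. if {u, w} \<in> snd G then v w else 0)"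
      using u by (intro sum.cong) (auto simp: edge_add_dominating)
    moreover have "(\<Sum>w\<in>{?n..<?n + k}. if {u, w} \<in> ?E then v w else 0) = (\<Sum>w\<in>{?n..<?n + k}. v w)"
      using u by (intro sum.cong) (auto simp: edge_add_dominating)
    ultimately show "(\<Sum>w<?n. if {u, w} \<in> snd G then v w else 0) + (c + (\<Sum>w\<in>{?n..<?n + k}. v w)) = x * v u"
      using eq[of u] u by (simp add: sum_lessThan_add)
  qed
  show "c + (\<Sum>w<?n + k. v w) = (x + 1) * v u" if u: "u \<in> {?n..<?n + k}" for u
  proof -
    have no_edge: "{u, w} \<notin> snd G" for w
      using edge(1)[of u w] u by auto
    have "(\<Sum>w<?n + k. if {u, w} \<in> ?E then v w else 0) = (\<Sum>w<?n + k. if w = u then 0 else v w)"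
      using u no_edge by (intro sum.cong) (auto simp: edge_add_dominating)
    also have "\<dots> = (\<Sum>w\<in>{..<?n + k} - {u}. v w)"
      using u by (subst sum.remove[of _ u]) auto
    also have "\<dots> = (\<Sum>w<?n + k. v w) - v u"
      using u by (simp add: sum_diff1)
    finally show ?thesis using eq[of u] u by (simp add: algebra_simps)
  qed
qed

section \<open>The two slope estimates\<close>

lemma slope_above_add_isolated:
  assumes G: "is_ugraph G" and slope: "slope_above (1 + sqrt 2) x G"
    and x: "(- 1 - sqrt 2) / 2 \<le> x" "x < -1" and k: "k \<ge> 1"
  shows "slope_above (- (1 + sqrt 2)) x (add_isolated k G)"
  unfolding slope_above_def
proof (intro allI impI)
  fix v c assume eig: "shifted_eigen x (add_isolated k G) v c"
  let ?n = "fst G" and ?\<theta> = "1 + sqrt 2 :: real"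
  define D where "D = c + (\<Sum>w<?n. v w)"
  note old = shifted_eigen_add_isolated(1)[OF G eig]
  have new: "v u = c / x" if "u \<in> {?n..<?n + k}" for u
    using shifted_eigen_add_isolated(2)[OF G eig that] x by (simp add: field_simps)
  have D': "c + (\<Sum>w<?n + k. v w) = D + k * c / x"
    using new by (simp add: sum_lessThan_add D_def)
  consider "c = 0" "\<forall>u<?n. v u = 0" | "D \<noteq> 0" "c / D > ?\<theta>"
    using slope old unfolding slope_above_def D_def by blast
  then show "(c = 0 \<and> (\<forall>u<fst (add_isolated k G). v u = 0)) \<or>
     (c + (\<Sum>w<fst (add_isolated k G). v w) \<noteq> 0 \<and>
      c / (c + (\<Sum>w<fst (add_isolated k G). v w)) > - ?\<theta>)"
  proof cases
    case 1
    then have "v u = 0" if "u < ?n + k" for u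
      using new[of u] that by (cases "u < ?n") auto
    with 1 show ?thesis by simp
  next
    case 2
    \<comment> \<open>In these terms the slope changes from \<open>q\<close> to
      \<open>q / (1 - q * b)\<close>.\<close>
    define q where "q = c / D"
    define b where "b = k / (- x)"
    have c: "c = q * D" and q: "q > ?\<theta>" using 2 by (auto simp: q_def)
    have q0: "q > 0" using q by (smt (verit) real_sqrt_ge_zero)
    \<comment> \<open>The left end of the interval is \<open>- ?\<theta> / 2\<close>, so
      \<open>- x \<le> ?\<theta> / 2\<close>.\<close>
    have b: "?\<theta> * b \<ge> 2"
    proof -
      have "2 * (- x) \<le> ?\<theta>" using x by simp
      also have "\<dots> \<le> ?\<theta> * k" using k mult_left_mono[of 1 "real k" ?\<theta>] by simp
      finally show ?thesis using x unfolding b_def by (simp add: field_simps)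
    qed
    have "b > 0" using k x by (simp add: b_def divide_pos_neg)
    then have "?\<theta> * b < q * b" using q by simp
    then have neg: "1 - q * b < -1" using b by linarith
    \<comment> \<open>The target is \<open>?\<theta> * b * q - ?\<theta> > q\<close>, which follows
      from \<open>2 * q - ?\<theta> > q\<close>. The new denominator is negative, so dividing by it
      reverses the inequality.\<close>
    have "2 * q \<le> (?\<theta> * b) * q" using b q0 by (intro mult_right_mono) auto
    then have "q < - ?\<theta> * (1 - q * b)" using q by (simp add: algebra_simps)
    then have "q / (1 - q * b) > - ?\<theta>" using neg by (simp add: neg_less_divide_eq)
    moreover have "D + k * c / x = D * (1 - q * b)"
      using x unfolding b_def c by (simp add: field_simps)
    ultimately show ?thesis using 2 neg unfolding fst_add_isolated D' by (simp add: c)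
  qed
qed

text \<open>The sum \<open>D\<close> is the same for both graphs, so the slope is merely translated
  by \<open>k / (- x - 1)\<close>. This shift is at least twice \<open>1 + sqrt 2\<close>, enough to
  flip the sign of the bound.\<close>

lemma slope_above_add_dominating:
  assumes G: "is_ugraph G" and slope: "slope_above (- (1 + sqrt 2)) x G"
    and x: "(- 1 - sqrt 2) / 2 \<le> x" "x < -1" and k: "k \<ge> 1"
  shows "slope_above (1 + sqrt 2) x (add_dominating k G)"
  unfolding slope_above_def
proof (intro allI impI)
  fix v c assume eig: "shifted_eigen x (add_dominating k G) v c"
  let ?n = "fst G" and ?\<theta> = "1 + sqrt 2 :: real"
  define D where "D = c + (\<Sum>w<?n + k. v w)"
  define c' where "c' = c + (\<Sum>w\<in>{?n..<?n + k}. v w)"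
  have new: "v u = D / (x + 1)" if "u \<in> {?n..<?n + k}" for u
    using shifted_eigen_add_dominating(2)[OF G eig that] x by (simp add: D_def field_simps)
  have D: "D = c' + (\<Sum>w<?n. v w)"
    by (simp add: D_def c'_def sum_lessThan_add)
  have c': "c' = c + k * D / (x + 1)"
    using new by (simp add: c'_def)
  consider "c' = 0" "\<forall>u<?n. v u = 0" | "D \<noteq> 0" "c' / D > - ?\<theta>"
    using slope shifted_eigen_add_dominating(1)[OF G eig]
    unfolding slope_above_def D c'_def[symmetric] by blast
  then show "(c = 0 \<and> (\<forall>u<fst (add_dominating k G). v u = 0)) \<or>
     (c + (\<Sum>w<fst (add_dominating k G). v w) \<noteq> 0 \<and>
      c / (c + (\<Sum>w<fst (add_dominating k G). v w)) > ?\<theta>)"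
  proof cases
    case 1
    then have "D = 0" using D by simp
    with 1 have "v u = 0" if "u < ?n + k" for u
      using new[of u] that by (cases "u < ?n") auto
    then show ?thesis using c' 1 \<open>D = 0\<close> by simp
  next
    case 2
    \<comment> \<open>At the left end of the interval \<open>- x - 1\<close> equals
      \<open>(sqrt 2 - 1) / 2\<close>, the reciprocal of \<open>2 * ?\<theta>\<close>.\<close>
    have "2 * ?\<theta> * (- x - 1) \<le> 2 * ?\<theta> * ((sqrt 2 - 1) / 2)"
      using x by (intro mult_left_mono) auto
    also have "\<dots> = 1" by (simp add: field_simps)
    finally have "2 * ?\<theta> * (- x - 1) \<le> k" using k by linarith
    then have large: "k / (- x - 1) \<ge> 2 * ?\<theta>" using x by (simp add: pos_le_divide_eq)
    have "?\<theta> = - ?\<theta> + 2 * ?\<theta>" by simp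
    also have "\<dots> < c' / D + k / (- x - 1)" by (rule add_less_le_mono[OF 2(2) large])
    also have "k / (- x - 1) = - (k / (x + 1))" unfolding minus_divide_right by simp
    also have "c' / D + - (k / (x + 1)) = c / D"
      using \<open>D \<noteq> 0\<close> by (simp add: c' add_divide_distrib)
    finally have "c / D > ?\<theta>" .
    then show ?thesis using 2 unfolding fst_add_dominating D_def by simp
  qed
qed

section \<open>Threshold graphs of odd length\<close>

lemma complete_graph_eq_add_dominating: "complete_graph n = add_dominating n (empty_graph 0)"
  by (auto simp: complete_graph_def add_dominating_def empty_graph_def)

text \<open>The initial complete graph counts as a dominating step over the graph without vertices.
  As \<open>r\<close> is odd, dominating and isolated steps then alternate, the even stages being
  dominating.\<close>

lemma slope_above_threshold_stage:
  assumes "odd r" and a: "\<forall>i\<in>{1..r}. a i \<ge> 1"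
    and x: "(- 1 - sqrt 2) / 2 \<le> x" "x < -1" and "k < r"
  shows "slope_above (if even k then 1 + sqrt 2 else - (1 + sqrt 2)) x (threshold_stage r a k)"
  using \<open>k < r\<close>
proof (induction k)
  case 0
  \<comment> \<open>Without vertices the sum is \<open>c\<close> itself, so the slope is 1 unless
    \<open>c = 0\<close>.\<close>
  have "slope_above (- (1 + sqrt 2)) x (empty_graph 0)"
    by (auto simp: slope_above_def empty_graph_def intro: add_pos_nonneg)
      (smt (verit) real_sqrt_ge_zero)
  moreover have "is_ugraph (empty_graph 0)"
    by (simp add: is_ugraph_def empty_graph_def)
  moreover have "a r \<ge> 1" using a 0 by simp
  ultimately show ?case
    using \<open>odd r\<close> slope_above_add_dominating x by (simp add: complete_graph_eq_add_dominating)
next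
  case (Suc k)
  have ai: "a (r - Suc k) \<ge> 1" using a Suc.prems by simp
  have "odd (r - Suc k) \<longleftrightarrow> odd k" using \<open>odd r\<close> Suc.prems by auto
  then show ?case
    using Suc slope_above_add_dominating[OF is_ugraph_threshold_stage _ x ai]
      slope_above_add_isolated[OF is_ugraph_threshold_stage _ x ai]
    by (auto simp: Let_def)
qed

lemma eigenvalue_imp_shifted_eigen:
  assumes "eigenvalue (adj_mat G) x"
  obtains v where "shifted_eigen x G v 0" "\<exists>u<fst G. v u \<noteq> 0"
proof -
  obtain v where v: "eigenvector (adj_mat G) v x"
    using assms by (auto simp: eigenvalue_def)
  then have dim: "v \<in> carrier_vec (fst G)" and nz: "v \<noteq> 0\<^sub>v (fst G)"
    and eq: "adj_mat G *\<^sub>v v = x \<cdot>\<^sub>v v"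
    by (auto simp: eigenvector_def adj_mat_def)
  have "shifted_eigen x G (vec_index v) 0"
    unfolding shifted_eigen_def
  proof (intro allI impI)
    fix u assume u: "u < fst G"
    have "x * v $ u = (adj_mat G *\<^sub>v v) $ u" using eq u dim by simp
    also have "\<dots> = (\<Sum>w<fst G. (if {u, w} \<in> snd G then 1 else 0) * v $ w)"
      using u dim by (auto simp: adj_mat_def scalar_prod_def lessThan_atLeast0 intro!: sum.cong)
    also have "\<dots> = (\<Sum>w<fst G. if {u, w} \<in> snd G then v $ w else 0)"
      by (intro sum.cong) auto
    finally show "(\<Sum>w<fst G. if {u, w} \<in> snd G then v $ w else 0) + 0 = x * v $ u" by simp
  qed
  moreover have "\<exists>u<fst G. v $ u \<noteq> 0"
    using nz dim by (metis carrier_vecD eq_vecI index_zero_vec)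
  ultimately show thesis using that by blast
qed

lemma eigenvalue_free_threshold_graph:
  assumes "odd r" and "\<forall>i\<in>{1..r}. a i \<ge> 1"
  shows "eigenvalue_free {(- 1 - sqrt 2) / 2..<-1} (threshold_graph r a)"
  unfolding eigenvalue_free_def
proof
  assume "\<exists>x\<in>{(- 1 - sqrt 2) / 2..<-1}. eigenvalue (adj_mat (threshold_graph r a)) x"
  then obtain x where x: "(- 1 - sqrt 2) / 2 \<le> x" "x < -1"
    and eig: "eigenvalue (adj_mat (threshold_graph r a)) x"
    by auto
  from eig obtain v
    where v: "shifted_eigen x (threshold_graph r a) v 0" "\<exists>u<fst (threshold_graph r a). v u \<noteq> 0"
    by (rule eigenvalue_imp_shifted_eigen)
  have "r - 1 < r" "even (r - 1)" using \<open>odd r\<close> odd_pos by auto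
  then have "slope_above (1 + sqrt 2) x (threshold_graph r a)"
    using slope_above_threshold_stage[OF assms x, of "r - 1"] by (simp add: threshold_graph_def)
  then have "(\<forall>u<fst (threshold_graph r a). v u = 0) \<or>
      0 / (0 + (\<Sum>w<fst (threshold_graph r a). v w)) > 1 + sqrt 2"
    using v(1) unfolding slope_above_def by blast
  \<comment> \<open>An eigenvector has \<open>c = 0\<close>, hence slope 0, below the bound.\<close>
  moreover have "\<not> 1 + sqrt 2 < (0::real)" by (simp add: not_less)
  ultimately show False using v(2) by auto
qed

section \<open>The run of the procedure, bounded above by a 2-cycle of its two maps\<close>

definition procedure_inv :: "nat \<Rightarrow> real \<Rightarrow> bool" where
  "procedure_inv i s \<longleftrightarrow> (if odd i then 1 < s \<and> s < 1 + sqrt 2 / 2 else 0 < s \<and> s < sqrt 2 / 2)"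

lemma sqrt_2_bounds: "7 / 5 < sqrt (2::real)" "sqrt (2::real) < 3 / 2"
  by (rule real_less_rsqrt, simp add: power2_eq_square)
    (rule real_less_lsqrt, simp_all add: power2_eq_square)

text \<open>For multiplicity 1 the second argument of both \<open>f_op\<close> and
  \<open>g_op\<close> is \<open>- M\<close>. The upper bounds in \<open>procedure_inv\<close> are
  exchanged by these maps: \<open>g_op\<close> sends \<open>1 + sqrt 2 / 2\<close> to
  \<open>sqrt 2 / 2\<close>, and \<open>f_op\<close> sends it back.\<close>

lemma procedure_step_even:
  fixes M s :: real
  assumes M: "M = (- 1 - sqrt 2) / 2" and s: "1 < s" "s < 1 + sqrt 2 / 2"
  shows "\<lfloor>- M + M / s\<rfloor> = 0" and "0 < g_op s (- M)" and "g_op s (- M) < sqrt 2 / 2"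
proof -
  note b = sqrt_2_bounds
  have "- M * (s - 1) < s"
  proof -
    have "- M * (s - 1) \<le> (5 / 4) * (s - 1)"
      using M b s by (intro mult_right_mono) auto
    also have "\<dots> < s" using s b by simp
    finally show ?thesis .
  qed
  moreover have "0 \<le> - M * (s - 1)" using M s b by (intro mult_nonneg_nonneg) auto
  moreover have "- M + M / s = - M * (s - 1) / s" using s by (simp add: field_simps)
  ultimately show "\<lfloor>- M + M / s\<rfloor> = 0" using s by (simp add: floor_eq_iff pos_divide_less_eq pos_le_divide_eq del: mult_minus_left)
  have pos: "- M > 0" using M b by simp
  then show "0 < g_op s (- M)" using s unfolding g_op_def by (intro divide_pos_pos mult_pos_pos) auto
  \<comment> \<open>Cleared of its denominator, the upper bound is linear in \<open>s\<close> and is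
    an equality exactly at \<open>1 + sqrt 2 / 2\<close>.\<close>
  have "0 < (1 + sqrt 2 / 2 - s) / 2" using s by simp
  also have "\<dots> = sqrt 2 / 2 * (s - M) - s * (- M)"
    unfolding M by (simp add: field_simps)
  finally have "s * (- M) < sqrt 2 / 2 * (s - M)" by (simp only: diff_gt_0_iff_gt)
  then show "g_op s (- M) < sqrt 2 / 2"
    using s pos unfolding g_op_def by (subst pos_divide_less_eq) auto
qed

lemma procedure_step_odd:
  fixes M s :: real
  assumes M: "M = (- 1 - sqrt 2) / 2" and s: "0 < s" "s < sqrt 2 / 2"
  shows "\<lfloor>(- M - 1) / (1 - s)\<rfloor> = 0" and "s + (1 - (M + 1)) - 2 < 0"
    and "1 < f_op s (1 - (M + 1))" and "f_op s (1 - (M + 1)) < 1 + sqrt 2 / 2"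
proof -
  note b = sqrt_2_bounds
  have s1: "s < 1" using s b by linarith
  show "\<lfloor>(- M - 1) / (1 - s)\<rfloor> = 0"
    using M s b s1 by (simp add: floor_eq_iff pos_divide_less_eq)
  show neg: "s + (1 - (M + 1)) - 2 < 0" using M s b by simp
  \<comment> \<open>With \<open>Y = - M\<close>, the difference
    \<open>(s * Y - 1) - (s + Y - 2)\<close> is \<open>(s - 1) * (Y - 1)\<close>, negative because
    \<open>s < 1 < Y\<close>. The denominator is negative, so the quotient exceeds 1.\<close>
  have "(- M - 1) * s < (- M - 1) * 1" using M b s1 by (intro mult_strict_left_mono) auto
  then have "s * (1 - (M + 1)) - 1 < 1 * (s + (1 - (M + 1)) - 2)" by (simp add: algebra_simps)
  then show "1 < f_op s (1 - (M + 1))"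
    unfolding f_op_def by (subst neg_less_divide_eq[OF neg]) simp
  have "0 < (sqrt 2 / 2 - s) / 2" using s by simp
  also have "\<dots> = s * (1 - (M + 1)) - 1 - (1 + sqrt 2 / 2) * (s + (1 - (M + 1)) - 2)"
    unfolding M by (simp add: field_simps)
  finally have "(1 + sqrt 2 / 2) * (s + (1 - (M + 1)) - 2) < s * (1 - (M + 1)) - 1"
    by (simp only: diff_gt_0_iff_gt)
  then show "f_op s (1 - (M + 1)) < 1 + sqrt 2 / 2"
    unfolding f_op_def by (subst neg_divide_less_eq[OF neg]) simp
qed

lemma procedure_inv_start:
  assumes "M = (- 1 - sqrt 2) / 2" "odd r"
  shows "procedure_inv r (1 - (M + 1) / 2)"
proof -
  define e where "e = (M + 1) / 2"
  have "e < 0" "- 1 / 4 < e" using assms(1) sqrt_2_bounds by (simp_all add: e_def)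
  then show ?thesis
    using \<open>odd r\<close> sqrt_2_bounds(1) unfolding procedure_inv_def e_def[symmetric] by simp
qed

lemma procedure_inv_step:
  assumes M: "M = (- 1 - sqrt 2) / 2" and s: "procedure_inv (Suc i) s"
  shows "odd i \<Longrightarrow> \<lfloor>(- M - 1) / (1 - s)\<rfloor> = 0 \<and> 1 - s \<noteq> 0 \<and> s + (1 - (M + 1)) - 2 \<noteq> 0 \<and>
           procedure_inv i (f_op s (1 - (M + 1)))"
    and "even i \<Longrightarrow> \<lfloor>- M + M / s\<rfloor> = 0 \<and> s \<noteq> 0 \<and> s + - M \<noteq> 0 \<and>
           procedure_inv i (g_op s (- M))"
proof -
  assume "odd i"
  then show "\<lfloor>(- M - 1) / (1 - s)\<rfloor> = 0 \<and> 1 - s \<noteq> 0 \<and> s + (1 - (M + 1)) - 2 \<noteq> 0 \<and>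
           procedure_inv i (f_op s (1 - (M + 1)))"
    using s procedure_step_odd[OF M, of s] sqrt_2_bounds unfolding procedure_inv_def by auto
next
  assume "even i"
  have "M < 0" using M sqrt_2_bounds by simp
  with \<open>even i\<close> show "\<lfloor>- M + M / s\<rfloor> = 0 \<and> s \<noteq> 0 \<and> s + - M \<noteq> 0 \<and> procedure_inv i (g_op s (- M))"
    using s procedure_step_even[OF M, of s] \<open>M < 0\<close> unfolding procedure_inv_def by auto
qed

text \<open>Without a run, the claim about all runs would be vacuous.\<close>

lemma procedure_run_exists:
  assumes M: "M = (- 1 - sqrt 2) / 2" and "odd r"
  shows "\<exists>a s. procedure_run M r a s"
proof -
  \<comment> \<open>\<open>t k\<close> is the value s at index \<open>r - k\<close>. The recursion
    has all multiplicities below \<open>r\<close> preset to 1; the invariant shows afterwards that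
    the floors vanish, so that the procedure makes this choice.\<close>
  define t where "t = rec_nat (1 - (M + 1) / 2)
    (\<lambda>k y. if odd (r - Suc k) then f_op y (1 - (M + 1)) else g_op y (- M))"
  have t0: "t 0 = 1 - (M + 1) / 2" by (simp add: t_def)
  have tS: "t (Suc k) = (if odd (r - Suc k) then f_op (t k) (1 - (M + 1)) else g_op (t k) (- M))" for k
    by (simp add: t_def)
  have inv: "k < r \<Longrightarrow> procedure_inv (r - k) (t k)" for k
  proof (induction k)
    case 0
    then show ?case using procedure_inv_start[OF assms] by (simp add: t0)
  next
    case (Suc k)
    then have "Suc (r - Suc k) = r - k" by simp
    then show ?case using Suc procedure_inv_step[OF M, of "r - Suc k" "t k"] by (simp add: tS)
  qed
  have "procedure_run M r (\<lambda>i. if i = r then 2 else 1) (\<lambda>i. t (r - i))"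
    unfolding procedure_run_def
  proof (intro conjI ballI)
    fix i assume i: "i \<in> {1..<r}"
    then have k: "r - i = Suc (r - Suc i)" "r - Suc (r - Suc i) = i" "r - (r - Suc i) = Suc i"
      by auto
    have "procedure_inv (Suc i) (t (r - Suc i))"
      using inv[of "r - Suc i"] i k by simp
    note step = procedure_inv_step[OF M this]
    have ti: "t (r - i) = (if odd i then f_op (t (r - Suc i)) (1 - (M + 1)) else g_op (t (r - Suc i)) (- M))"
      using tS[of "r - Suc i"] unfolding k(1) k(2) .
    have ir: "i \<noteq> r" using i by simp
    show "odd i \<longrightarrow> int (if i = r then 2 else 1) = 1 + \<lfloor>(- M - 1) / (1 - t (r - (i + 1)))\<rfloor> \<and>
      t (r - i) = f_op (t (r - (i + 1))) (1 - (M + 1) / real (if i = r then 2 else 1))"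
      using step(1) ir ti by auto
    show "even i \<longrightarrow> int (if i = r then 2 else 1) = 1 + \<lfloor>- M + M / t (r - (i + 1))\<rfloor> \<and>
      t (r - i) = g_op (t (r - (i + 1))) (- (M / real (if i = r then 2 else 1)))"
      using step(2) ir ti by auto
  qed (simp_all add: t0)
  then show ?thesis by blast
qed

text \<open>A vanishing floor forces \<open>a i = 1\<close>, which turns the actual update into the
  one that preserves the invariant.\<close>

lemma procedure_run_step:
  assumes M: "M = (- 1 - sqrt 2) / 2" and run: "procedure_run M r a s"
    and i: "i \<in> {1..<r}" and inv: "procedure_inv (Suc i) (s (Suc i))"
  shows "a i = 1 \<and> procedure_inv i (s i) \<and>
    (odd i \<longrightarrow> 1 - s (i + 1) \<noteq> 0 \<and> s (i + 1) + (1 - (M + 1) / real (a i)) - 2 \<noteq> 0) \<and>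
    (even i \<longrightarrow> s (i + 1) \<noteq> 0 \<and> s (i + 1) + - (M / real (a i)) \<noteq> 0)"
proof (cases "odd i")
  case True
  then have "int (a i) = 1 + \<lfloor>(- M - 1) / (1 - s (Suc i))\<rfloor>"
    and si: "s i = f_op (s (Suc i)) (1 - (M + 1) / real (a i))"
    using run i unfolding procedure_run_def by auto
  moreover note step = procedure_inv_step(1)[OF M inv True]
  ultimately have "a i = 1" by simp
  then show ?thesis using step si True by simp
next
  case False
  then have "int (a i) = 1 + \<lfloor>- M + M / s (Suc i)\<rfloor>"
    and si: "s i = g_op (s (Suc i)) (- (M / real (a i)))"
    using run i unfolding procedure_run_def by auto
  moreover have step: "\<lfloor>- M + M / s (Suc i)\<rfloor> = 0 \<and> s (Suc i) \<noteq> 0 \<and> s (Suc i) + - M \<noteq> 0 \<and>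
      procedure_inv i (g_op (s (Suc i)) (- M))"
    using procedure_inv_step(2)[OF M inv] False by blast
  ultimately have "a i = 1" by simp
  then show ?thesis using step si False by simp
qed

lemma procedure_run_inv:
  assumes M: "M = (- 1 - sqrt 2) / 2" and "odd r" and run: "procedure_run M r a s"
    and "1 \<le> i" "i \<le> r"
  shows "procedure_inv i (s i)"
  using \<open>i \<le> r\<close> \<open>1 \<le> i\<close>
proof (induction rule: inc_induct)
  case base
  then show ?case
    using run procedure_inv_start[OF M \<open>odd r\<close>] unfolding procedure_run_def by simp
next
  case (step n)
  then show ?case using procedure_run_step[OF M run, of n] by simp
qed

theorem theorem9:
  fixes M :: real and r :: nat
  assumes "M = (- 1 - sqrt 2) / 2"
    and "odd r"
  shows "(\<exists>a s. procedure_run M r a s) \<and>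
         (\<forall>a s. procedure_run M r a s \<longrightarrow>
            procedure_defined M r a s \<and> (\<forall>i\<in>{1..<r}. a i = 1)) \<and>
         eigenvalue_free {M..<-1} (threshold_graph r (\<lambda>i. if i = r then 2 else 1)) \<and>
         (\<forall>a :: nat \<Rightarrow> nat. a r \<ge> 2 \<and> (\<forall>i\<in>{1..<r}. a i \<ge> 1) \<longrightarrow>
            eigenvalue_free {M..<-1} (threshold_graph r a))"
proof -
  have "procedure_defined M r a s \<and> (\<forall>i\<in>{1..<r}. a i = 1)" if run: "procedure_run M r a s" for a s
  proof -
    have "procedure_inv (Suc i) (s (Suc i))" if "i \<in> {1..<r}" for i
      using procedure_run_inv[OF assms run, of "Suc i"] that by simp
    note step = procedure_run_step[OF assms(1) run _ this]
    then have one: "a i = 1" if "i \<in> {1..<r}" for i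
      using that by blast
    then have "a i \<noteq> 0" if "i \<in> {1..<r}" for i
      using that by simp
    then show ?thesis
      using step one unfolding procedure_defined_def by blast
  qed
  \<comment> \<open>This rests on the slope estimates alone, not on the run of the procedure; the
    graph with multiplicities 1, ..., 1, 2 is an instance.\<close>
  moreover have "eigenvalue_free {M..<-1} (threshold_graph r a)"
    if "a r \<ge> 2 \<and> (\<forall>i\<in>{1..<r}. a i \<ge> 1)" for a
  proof -
    have "a i \<ge> 1" if "i \<in> {1..r}" for i
      using that \<open>a r \<ge> 2 \<and> _\<close> by (cases "i = r") auto
    then show ?thesis
      unfolding assms(1) by (intro eigenvalue_free_threshold_graph[OF \<open>odd r\<close>]) blast
  qed
  ultimately show ?thesis using procedure_run_exists[OF assms] by simp
qed

end
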